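(* Let $\epsilon_d>0$ and $\beta_{\max}>\beta_{\min}>0$ be constants (independent of $k$). For each iteration $k$, let $g_k\in\mathbb{R}^n\setminus\{0\}$, let $B_k$ be a symmetric matrix, and let $s_k^Q$ be a stationary point of the quadratic model $m_k^Q$ such that $g_k^\top s_k^Q\neq0$ and $|g_k^\top s_k^Q|\ge\epsilon_d\|g_k\|\,\|s_k^Q\|$. If $$\theta_k=\beta_k\|s_k^Q\|^2\quad\text{where }\beta_k\in(\beta_{\min},\beta_{\max}),$$ then there exists a symmetric positive definite matrix $M_k$ such that: (i) $M_ks_k^Q=\dfrac{\theta_k}{g_k^\top s_k^Q}\,g_k$; (ii) the $M_k$-norm is uniformly (in $k$) equivalent to the $\ell_2$-norm on $\mathbb{R}^n$: for all $x\in\mathbb{R}^n$, $$\frac{\sqrt{\beta_{\min}}}{\sqrt2}\,\|x\|\le\|x\|_{M_k}\le\frac{\sqrt{2\beta_{\max}}}{\epsilon_d}\,\|x\|;$$ (iii) $\|s_k^Q\|_{M_k}^2=\beta_k\|s_k^Q\|^2$ and $\|g_k\|_{M_k}^2=\chi_k\|g_k\|^2$, where $$\chi_k=\beta_k\left(\frac52-\frac32\cos(\varpi_k)^2+2\left(\frac{1-\cos(\varpi_k)^2}{\cos(\varpi_k)}\right)^2\right),\qquad \cos(\varpi_k)=\frac{g_k^\top s_k^Q}{\|g_k\|\,\|s_k^Q\|}.$$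
   Context: $\|\cdot\|$ is the Euclidean norm and $\|x\|_{M_k}=\sqrt{x^\top M_kx}$. Here $f:\mathbb{R}^n\to\mathbb{R}$ is continuously differentiable, $x_k$ is the current iterate, $g_k=\nabla f(x_k)\ne0$, and $m_k^Q(s)=f(x_k)+s^\top g_k+\tfrac12s^\top B_ks$. The stationary point $s_k^Q$ may be a stationary point over $\mathbb{R}^n$ (i.e. $B_ks_k^Q=-g_k$) or over a linear subspace $\mathcal{L}_k$ (i.e. $s_k^Q\in\mathcal{L}_k$ and $Q_k^\top(g_k+B_ks_k^Q)=0$, where the columns of $Q_k$ form a basis of $\mathcal{L}_k$). *)

theory Defs
  imports "HOL-Analysis.Analysis"
begin

definition symmetric_matrix :: "real ^ 'n ^ 'n \<Rightarrow> bool" where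
  "symmetric_matrix A \<longleftrightarrow> transpose A = A"

definition spd_matrix :: "real ^ 'n ^ 'n \<Rightarrow> bool" where
  "spd_matrix A \<longleftrightarrow> symmetric_matrix A \<and> (\<forall>x. x \<noteq> 0 \<longrightarrow> x \<bullet> (A *v x) > 0)"

definition energy_norm :: "real ^ 'n ^ 'n \<Rightarrow> real ^ 'n \<Rightarrow> real" where
  "energy_norm M x = sqrt (x \<bullet> (M *v x))"

definition quadratic_model :: "real \<Rightarrow> real ^ 'n \<Rightarrow> real ^ 'n ^ 'n \<Rightarrow> real ^ 'n \<Rightarrow> real" where
  "quadratic_model c g B s = c + s \<bullet> g + 1 / 2 * (s \<bullet> (B *v s))"

definition cos_angle :: "real ^ 'n \<Rightarrow> real ^ 'n \<Rightarrow> real" where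
  "cos_angle g s = (g \<bullet> s) / (norm g * norm s)"

definition stationary_point :: "(real ^ 'n \<Rightarrow> real) \<Rightarrow> real ^ 'n \<Rightarrow> bool" where
  "stationary_point m s \<longleftrightarrow> (GDERIV m s :> 0)"

text \<open>The set \<open>Q\<close> consists of the columns of the basis matrix of \<open>L\<close>, whose number may
  change from one subspace to the next (and be zero). The conjunct \<open>\<forall>q\<in>Q. q \<bullet> G = 0\<close> says that
  the transpose of that matrix maps the gradient \<open>G\<close> of \<open>m\<close> at \<open>s\<close> to zero.\<close>

definition stationary_point_over ::
    "(real ^ 'n) set \<Rightarrow> (real ^ 'n \<Rightarrow> real) \<Rightarrow> real ^ 'n \<Rightarrow> bool" where
  "stationary_point_over L m s \<longleftrightarrow> subspace L \<and> s \<in> L \<and>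
     (\<exists>G Q. (GDERIV m s :> G) \<and> independent Q \<and> span Q = L \<and> (\<forall>q\<in>Q. q \<bullet> G = 0))"

lemma GDERIV_unique:
  assumes "GDERIV m s :> G" and "GDERIV m s :> G'"
  shows "G = G'"
proof -
  have "(\<lambda>h. h \<bullet> G) = (\<lambda>h. h \<bullet> G')"
    using assms unfolding gderiv_def by (rule has_derivative_unique)
  then have "\<forall>h. h \<bullet> G = h \<bullet> G'"
    by (simp add: fun_eq_iff)
  then show ?thesis
    by (simp only: vector_eq_ldot)
qed

lemma GDERIV_quadratic_model:
  assumes "symmetric_matrix B"
  shows "GDERIV (quadratic_model c g B) s :> g + B *v s"
proof -
  have "s \<bullet> (B *v h) = (transpose B *v s) \<bullet> h" for h
    by (simp add: dot_lmul_matrix)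
  with assms have sym: "s \<bullet> (B *v h) = h \<bullet> (B *v s)" for h
    by (simp add: symmetric_matrix_def inner_commute)
  have B: "((*v) B has_derivative (*v) B) (at s)"
    by (rule bounded_linear_imp_has_derivative) simp
  have "((\<lambda>s. s \<bullet> (B *v s)) has_derivative (\<lambda>h. s \<bullet> (B *v h) + h \<bullet> (B *v s))) (at s)"
    by (rule has_derivative_inner[OF has_derivative_ident B])
  then have "((\<lambda>s. 1 / 2 * (s \<bullet> (B *v s))) has_derivative
      (\<lambda>h. 1 / 2 * (s \<bullet> (B *v h) + h \<bullet> (B *v s)))) (at s)"
    by (rule has_derivative_mult_right)
  moreover have "((\<lambda>s. c + s \<bullet> g) has_derivative (\<lambda>h. h \<bullet> g)) (at s)"
    by (auto intro!: derivative_eq_intros)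
  ultimately have "((\<lambda>s. c + s \<bullet> g + 1 / 2 * (s \<bullet> (B *v s))) has_derivative
      (\<lambda>h. h \<bullet> g + 1 / 2 * (s \<bullet> (B *v h) + h \<bullet> (B *v s)))) (at s)"
    by (rule has_derivative_add[rotated])
  then show ?thesis
    unfolding gderiv_def quadratic_model_def[abs_def] by (simp add: sym inner_add_right)
qed

lemma stationary_point_quadratic_model_iff:
  assumes "symmetric_matrix B"
  shows "stationary_point (quadratic_model c g B) s \<longleftrightarrow> B *v s = - g"
proof -
  note G = GDERIV_quadratic_model[OF assms, of c g s]
  have "stationary_point (quadratic_model c g B) s \<longleftrightarrow> g + B *v s = 0"
    unfolding stationary_point_def using G GDERIV_unique GDERIV_subst by blast
  then show ?thesis
    by (simp add: add_eq_0_iff)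
qed

lemma stationary_point_over_quadratic_model_iff:
  assumes "symmetric_matrix B"
  shows "stationary_point_over L (quadratic_model c g B) s \<longleftrightarrow>
    subspace L \<and> s \<in> L \<and>
    (\<exists>Q. independent Q \<and> span Q = L \<and> (\<forall>q\<in>Q. q \<bullet> (g + B *v s) = 0))"
proof -
  note G = GDERIV_quadratic_model[OF assms, of c g s]
  have "GDERIV (quadratic_model c g B) s :> G' \<longleftrightarrow> G' = g + B *v s" for G'
    using G GDERIV_unique by blast
  then show ?thesis
    by (simp add: stationary_point_over_def)
qed

end

theory Submission
  imports Defs
begin

text \<open>Write \<open>c\<close> for the cosine of the angle between \<open>g\<close> and \<open>s\<close>. The matrix
  \<open>M = \<beta>/2 (I + w w\<^sup>T)\<close> with \<open>w = 2 / (c \<parallel>g\<parallel>) g - s / \<parallel>s\<parallel>\<close> works: \<open>w\<close> has inner product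
  \<open>1\<close> with \<open>s / \<parallel>s\<parallel>\<close>, which yields the equation for \<open>M s\<close>, and \<open>\<parallel>w\<parallel>\<^sup>2 = 4 / c\<^sup>2 - 3\<close>, so the
  eigenvalues of \<open>M\<close> are \<open>\<beta>/2\<close> and \<open>\<beta> (2 / c\<^sup>2 - 1)\<close>, where \<open>c\<^sup>2 \<ge> \<epsilon>\<^sub>d\<^sup>2\<close>. On the span of \<open>s\<close>
  and \<open>g\<close> this choice is forced by the prescribed values of \<open>M s\<close> and \<open>\<parallel>g\<parallel>\<^sub>M\<close>.\<close>

definition rank_one_update :: "real \<Rightarrow> real ^ 'n \<Rightarrow> real ^ 'n ^ 'n" where
  "rank_one_update b w = (\<chi> i j. b / 2 * ((if i = j then 1 else 0) + w $ i * w $ j))"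

lemma rank_one_update_vec:
  "rank_one_update b w *v z = (b / 2) *\<^sub>R (z + (w \<bullet> z) *\<^sub>R w)"
proof -
  have "(\<Sum>j\<in>UNIV. b / 2 * ((if i = j then 1 else 0) + w $ i * w $ j) * z $ j)
      = b / 2 * (z $ i + (w \<bullet> z) * w $ i)" for i
  proof -
    have "(\<Sum>j\<in>UNIV. b / 2 * ((if i = j then 1 else 0) + w $ i * w $ j) * z $ j)
        = (\<Sum>j\<in>UNIV. b / 2 * ((if i = j then z $ j else 0) + w $ i * (w $ j * z $ j)))"
      by (rule sum.cong) (auto simp: algebra_simps)
    also have "\<dots> = b / 2 * (z $ i + w $ i * (\<Sum>j\<in>UNIV. w $ j * z $ j))"
      by (simp only: sum_distrib_left[symmetric] sum.distrib) simp
    finally show ?thesis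
      by (simp add: inner_vec_def mult.commute)
  qed
  then show ?thesis
    by (simp add: rank_one_update_def matrix_vector_mult_def vec_eq_iff)
qed

lemma inner_rank_one_update:
  "z \<bullet> (rank_one_update b w *v z) = b / 2 * ((norm z)\<^sup>2 + (w \<bullet> z)\<^sup>2)"
  by (simp add: rank_one_update_vec inner_add_right dot_square_norm power2_eq_square
      inner_commute)

lemma spd_rank_one_update:
  assumes "b > 0"
  shows "spd_matrix (rank_one_update b w)"
proof -
  have "symmetric_matrix (rank_one_update b w)"
    by (simp add: symmetric_matrix_def transpose_def rank_one_update_def vec_eq_iff mult.commute)
  then show ?thesis
    using assms by (simp add: spd_matrix_def inner_rank_one_update add_pos_nonneg)
qed

lemma energy_norm_sq_rank_one_update:
  assumes "b > 0"
  shows "(energy_norm (rank_one_update b w) z)\<^sup>2 = b / 2 * ((norm z)\<^sup>2 + (w \<bullet> z)\<^sup>2)"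
  using assms by (simp add: energy_norm_def inner_rank_one_update)

lemma energy_norm_rank_one_update_ge:
  assumes "0 < a" "a \<le> b"
  shows "sqrt a / sqrt 2 * norm z \<le> energy_norm (rank_one_update b w) z"
proof -
  have "sqrt a / sqrt 2 * norm z = sqrt (a / 2 * (norm z)\<^sup>2)"
    by (simp add: real_sqrt_mult real_sqrt_divide)
  also have "\<dots> \<le> sqrt (b / 2 * ((norm z)\<^sup>2 + (w \<bullet> z)\<^sup>2))"
    using assms by (intro real_sqrt_le_mono mult_mono) auto
  finally show ?thesis
    by (simp add: energy_norm_def inner_rank_one_update)
qed

text \<open>Cauchy-Schwarz bounds the rank-one term. The \<open>- 1\<close> in the bound on
  \<open>w\<close> makes room for the identity term, so the bracket is at most
  \<open>4 / e\<^sup>2\<close> times the squared norm of \<open>z\<close>.\<close>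

lemma energy_norm_rank_one_update_le:
  assumes "0 < b" "b \<le> a" "0 < e" and w: "(norm w)\<^sup>2 \<le> 4 / e\<^sup>2 - 1"
  shows "energy_norm (rank_one_update b w) z \<le> sqrt (2 * a) / e * norm z"
proof -
  have "(w \<bullet> z)\<^sup>2 \<le> (norm w)\<^sup>2 * (norm z)\<^sup>2"
    using Cauchy_Schwarz_ineq[of w z] by (simp add: power2_norm_eq_inner)
  also have "\<dots> \<le> (4 / e\<^sup>2 - 1) * (norm z)\<^sup>2"
    using w by (rule mult_right_mono) simp
  finally have "(norm z)\<^sup>2 + (w \<bullet> z)\<^sup>2 \<le> 4 / e\<^sup>2 * (norm z)\<^sup>2"
    by (simp add: algebra_simps)
  then have "b / 2 * ((norm z)\<^sup>2 + (w \<bullet> z)\<^sup>2) \<le> a / 2 * (4 / e\<^sup>2 * (norm z)\<^sup>2)"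
    using assms by (intro mult_mono) auto
  also have "\<dots> = 2 * a / e\<^sup>2 * (norm z)\<^sup>2"
    by simp
  finally have "energy_norm (rank_one_update b w) z \<le> sqrt (2 * a / e\<^sup>2 * (norm z)\<^sup>2)"
    by (simp add: energy_norm_def inner_rank_one_update)
  also have "\<dots> = sqrt (2 * a) / e * norm z"
    using assms by (simp add: real_sqrt_mult real_sqrt_divide)
  finally show ?thesis .
qed

text \<open>The coefficient of \<open>g\<close> is \<open>2 / (c * norm g)\<close> with the cosine
  written out. Adding the unit vector along \<open>s\<close> leaves a multiple of \<open>g\<close>,
  which is why the matrix can send \<open>s\<close> to the line of \<open>g\<close>.\<close>

definition update_direction :: "real ^ 'n \<Rightarrow> real ^ 'n \<Rightarrow> real ^ 'n" where
  "update_direction g s = (2 * norm s / (g \<bullet> s)) *\<^sub>R g - (1 / norm s) *\<^sub>R s"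

lemma update_direction_inner_right:
  assumes "g \<bullet> s \<noteq> 0"
  shows "update_direction g s \<bullet> s = norm s"
proof -
  have "norm s \<noteq> 0"
    using assms by auto
  then show ?thesis
    using assms unfolding update_direction_def
    by (simp add: inner_diff_left dot_square_norm power2_eq_square)
qed

text \<open>This value enters twice: in the norm of the update direction and in the energy norm of
  \<open>g\<close>.\<close>

lemma update_direction_inner_left:
  assumes "g \<bullet> s \<noteq> 0"
  shows "update_direction g s \<bullet> g = norm g * (2 / cos_angle g s - cos_angle g s)"
proof -
  have "norm s \<noteq> 0" "norm g \<noteq> 0"
    using assms by auto
  then show ?thesis
    using assms
    by (simp add: update_direction_def cos_angle_def inner_diff_left dot_square_norm
        inner_commute[of s g]) (simp add: field_simps power2_eq_square)
qed

lemma norm_update_direction: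
  assumes "g \<bullet> s \<noteq> 0"
  shows "(norm (update_direction g s))\<^sup>2 = 4 / (cos_angle g s)\<^sup>2 - 3"
proof -
  have nz: "norm s \<noteq> 0" "norm g \<noteq> 0"
    using assms by auto
  let ?w = "update_direction g s"
  \<comment> \<open>Only one factor of \<open>?w \<bullet> ?w\<close> is expanded, which leaves the
    two inner products already computed.\<close>
  have "(norm ?w)\<^sup>2 = 2 * norm s / (g \<bullet> s) * (?w \<bullet> g) - 1 / norm s * (?w \<bullet> s)"
    unfolding power2_norm_eq_inner
    by (subst (2) update_direction_def) (simp add: inner_diff_right)
  also have "\<dots> = 2 / cos_angle g s * (2 / cos_angle g s - cos_angle g s) - 1"
    using assms nz
    by (simp add: update_direction_inner_left update_direction_inner_right)
       (simp add: cos_angle_def)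
  also have "\<dots> = 4 / (cos_angle g s)\<^sup>2 - 3"
    using assms nz by (simp add: cos_angle_def field_simps power2_eq_square)
  finally show ?thesis .
qed

theorem theorem4p1:
  fixes \<epsilon>_d \<beta>_min \<beta>_max :: real
    and f :: "real ^ 'n \<Rightarrow> real"
    and grad_f :: "real ^ 'n \<Rightarrow> real ^ 'n"
    and x g s :: "nat \<Rightarrow> real ^ 'n"
    and B :: "nat \<Rightarrow> real ^ 'n ^ 'n"
    and \<beta> \<theta> :: "nat \<Rightarrow> real"
  assumes "\<epsilon>_d > 0" and "\<beta>_max > \<beta>_min" and "\<beta>_min > 0"
    and "\<And>y. GDERIV f y :> grad_f y" and "continuous_on UNIV grad_f"
    and "\<And>k. g k = grad_f (x k)" and "\<And>k. g k \<noteq> 0"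
    and "\<And>k. symmetric_matrix (B k)"
    and "\<And>k. stationary_point (quadratic_model (f (x k)) (g k) (B k)) (s k) \<or>
          (\<exists>L. stationary_point_over L (quadratic_model (f (x k)) (g k) (B k)) (s k))"
    and "\<And>k. g k \<bullet> s k \<noteq> 0"
    and "\<And>k. \<bar>g k \<bullet> s k\<bar> \<ge> \<epsilon>_d * norm (g k) * norm (s k)"
    and "\<And>k. \<beta> k \<in> {\<beta>_min<..<\<beta>_max}"
    and "\<And>k. \<theta> k = \<beta> k * (norm (s k))\<^sup>2"
  shows "\<forall>k. \<exists>M :: real ^ 'n ^ 'n. spd_matrix M \<and>
    M *v s k = (\<theta> k / (g k \<bullet> s k)) *\<^sub>R g k \<and>
    (\<forall>z. sqrt \<beta>_min / sqrt 2 * norm z \<le> energy_norm M z \<and>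
         energy_norm M z \<le> sqrt (2 * \<beta>_max) / \<epsilon>_d * norm z) \<and>
    (energy_norm M (s k))\<^sup>2 = \<beta> k * (norm (s k))\<^sup>2 \<and>
    (let c = cos_angle (g k) (s k);
         chi = \<beta> k * (5 / 2 - 3 / 2 * c\<^sup>2 + 2 * ((1 - c\<^sup>2) / c)\<^sup>2)
     in (energy_norm M (g k))\<^sup>2 = chi * (norm (g k))\<^sup>2)"
proof
  fix k
  define c where "c = cos_angle (g k) (s k)"
  define w where "w = update_direction (g k) (s k)"
  let ?M = "rank_one_update (\<beta> k) w"
  have gs: "g k \<bullet> s k \<noteq> 0" and \<beta>: "\<beta>_min < \<beta> k" "\<beta> k < \<beta>_max" "0 < \<beta> k"
    using assms(10) assms(12)[of k] \<open>\<beta>_min > 0\<close> by auto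
  then have pos: "norm (s k) > 0" "norm (g k) > 0"
    by auto
  have "c \<noteq> 0"
    using gs pos by (simp add: c_def cos_angle_def)
  have "\<epsilon>_d \<le> \<bar>c\<bar>"
    using assms(11)[of k] pos by (simp add: c_def cos_angle_def abs_mult field_simps)
  then have "\<epsilon>_d\<^sup>2 \<le> c\<^sup>2"
    using \<open>\<epsilon>_d > 0\<close> power_mono[of \<epsilon>_d "\<bar>c\<bar>" 2] by simp
  then have "4 / c\<^sup>2 \<le> 4 / \<epsilon>_d\<^sup>2"
    using \<open>\<epsilon>_d > 0\<close> by (intro divide_left_mono) (auto simp: \<open>c \<noteq> 0\<close>)
  \<comment> \<open>The exact value is \<open>4 / c\<^sup>2 - 3\<close>; the constant is relaxed to
    the \<open>- 1\<close> of the upper bound lemma.\<close>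
  then have "(norm w)\<^sup>2 \<le> 4 / \<epsilon>_d\<^sup>2 - 1"
    by (simp add: w_def norm_update_direction[OF gs] c_def)
  then have upper: "energy_norm ?M z \<le> sqrt (2 * \<beta>_max) / \<epsilon>_d * norm z" for z
    using \<beta> \<open>\<epsilon>_d > 0\<close> by (intro energy_norm_rank_one_update_le) auto
  have lower: "sqrt \<beta>_min / sqrt 2 * norm z \<le> energy_norm ?M z" for z
    using \<beta> \<open>\<beta>_min > 0\<close> by (intro energy_norm_rank_one_update_ge) auto
  have ws: "w \<bullet> s k = norm (s k)"
    by (simp add: w_def update_direction_inner_right[OF gs])
  \<comment> \<open>In \<open>s k + norm (s k) *\<^sub>R w\<close> the multiples of
    \<open>s k\<close> cancel, and the factor 2 on \<open>g k\<close> offsets the half in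
    \<open>\<beta> k / 2\<close>.\<close>
  have "?M *v s k = (\<theta> k / (g k \<bullet> s k)) *\<^sub>R g k"
    unfolding rank_one_update_vec ws using pos
    by (simp add: w_def update_direction_def assms(13) algebra_simps power2_eq_square)
  moreover have "(energy_norm ?M (s k))\<^sup>2 = \<beta> k * (norm (s k))\<^sup>2"
    by (simp add: energy_norm_sq_rank_one_update[OF \<beta>(3)] ws)
  moreover have "(energy_norm ?M (g k))\<^sup>2 =
      \<beta> k * (5 / 2 - 3 / 2 * c\<^sup>2 + 2 * ((1 - c\<^sup>2) / c)\<^sup>2) * (norm (g k))\<^sup>2"
  proof -
    \<comment> \<open>This is the square of \<open>2 / c - c = c + 2 * (1 - c\<^sup>2) / c\<close>,
      whose cross term is \<open>4 * (1 - c\<^sup>2)\<close>.\<close>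
    have "(1 + (2 / c - c)\<^sup>2) / 2 = 5 / 2 - 3 / 2 * c\<^sup>2 + 2 * ((1 - c\<^sup>2) / c)\<^sup>2"
      using \<open>c \<noteq> 0\<close> by (simp add: field_simps power2_eq_square)
    moreover have "w \<bullet> g k = norm (g k) * (2 / c - c)"
      by (simp add: w_def c_def update_direction_inner_left[OF gs])
    then have "(energy_norm ?M (g k))\<^sup>2 = \<beta> k * ((1 + (2 / c - c)\<^sup>2) / 2) * (norm (g k))\<^sup>2"
      by (simp only: energy_norm_sq_rank_one_update[OF \<beta>(3)] power_mult_distrib) (simp add: field_simps)
    ultimately show ?thesis
      by (simp only:)
  qed
  ultimately show "\<exists>M. spd_matrix M \<and>
    M *v s k = (\<theta> k / (g k \<bullet> s k)) *\<^sub>R g k \<and>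
    (\<forall>z. sqrt \<beta>_min / sqrt 2 * norm z \<le> energy_norm M z \<and>
         energy_norm M z \<le> sqrt (2 * \<beta>_max) / \<epsilon>_d * norm z) \<and>
    (energy_norm M (s k))\<^sup>2 = \<beta> k * (norm (s k))\<^sup>2 \<and>
    (let c = cos_angle (g k) (s k);
         chi = \<beta> k * (5 / 2 - 3 / 2 * c\<^sup>2 + 2 * ((1 - c\<^sup>2) / c)\<^sup>2)
     in (energy_norm M (g k))\<^sup>2 = chi * (norm (g k))\<^sup>2)"
    using spd_rank_one_update[OF \<beta>(3), of w] upper lower unfolding Let_def c_def by blast
qed

end
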